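(* Let $M$ be a topological monoid with neutral element $e$, let $\sigma: M\to M$ be an involutive automorphism, let $\tau: M\to M$ be an involutive anti-automorphism, and let $z_0$ be an arbitrarily fixed element of $M$. Consider the non-zero continuous solutions $f: M\to\mathbb{C}$ of the functional equation $$f(x\sigma(y)z_0)+f(\tau(y)xz_0)=2f(x)f(y)\quad\text{for all }x,y\in M.$$ There are two kinds of them, abelian and non-abelian: (1) Every abelian such $f$ is of the form $$f=f(e)\,\frac{\chi+\chi\circ\sigma\circ\tau}{2},$$ where $\chi: M\to\mathbb{C}$ is a continuous multiplicative function such that: (i) $\chi\circ\sigma\circ\tau=\chi\circ\tau\circ\sigma$; (ii) $\chi$ is $\sigma$-even and/or $\tau$-even (i.e. $\chi\circ\sigma=\chi$ or $\chi\circ\tau=\chi$, possibly both); and (iii) $\chi(\sigma(\tau(z_0)))=\chi(z_0)=f(e)$. (2) Every non-abelian such $f$ is of the form $$f(x)=\frac{f(e)\chi_\pi(x)}{2},\quad x\in M,$$ where $\pi$ is a continuous irreducible representation of $M$ of dimension $2$ for which $\operatorname{adj}(\pi(\sigma(x)))=\pi(\tau(x))$ and $\operatorname{tr}(\pi(x))=\operatorname{tr}(\pi(\sigma(x)))$ for all $x\in M$, and $\pi(z_0)=f(e)I_2$.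
   Context: $\sigma$ being an involutive automorphism means $\sigma(xy)=\sigma(x)\sigma(y)$ and $\sigma(\sigma(x))=x$ for all $x,y\in M$; $\tau$ being an involutive anti-automorphism means $\tau(xy)=\tau(y)\tau(x)$ and $\tau(\tau(x))=x$ for all $x,y\in M$. A function $\chi: M\to\mathbb{C}$ is multiplicative if $\chi(xy)=\chi(x)\chi(y)$ for all $x,y\in M$. A function $f: M\to\mathbb{C}$ is abelian if $f(x_1x_2\cdots x_n)=f(x_{\epsilon(1)}x_{\epsilon(2)}\cdots x_{\epsilon(n)})$ for every $n\ge 2$, all $x_1,\dots,x_n\in M$ and every permutation $\epsilon$ of $\{1,\dots,n\}$; non-abelian means not abelian. Vector spaces are complex. A representation of $M$ on a non-zero vector space $V$ is a map $\pi: M\to\mathcal{L}(V)$ into the linear operators on $V$ with $\pi(xy)=\pi(x)\pi(y)$ for all $x,y\in M$ and $\pi(e)=I$; its dimension is $\dim V$, and its character is $\chi_\pi(x)=\operatorname{tr}(\pi(x))$. For $A\in\mathcal{L}(V)$ with $\dim V=2$, $\operatorname{adj}(A)=(\operatorname{tr}A)I-A$ denotes the adjugate of $A$. $I_2$ is the identity operator of the $2$-dimensional representation space. Non-zero means not identically zero. *)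

theory Defs
  imports "HOL-Analysis.Analysis"
begin

definition involutive_automorphism :: "('m::monoid_mult \<Rightarrow> 'm) \<Rightarrow> bool" where
  "involutive_automorphism \<sigma> \<longleftrightarrow>
     (\<forall>x y. \<sigma> (x * y) = \<sigma> x * \<sigma> y) \<and> (\<forall>x. \<sigma> (\<sigma> x) = x)"

definition involutive_anti_automorphism :: "('m::monoid_mult \<Rightarrow> 'm) \<Rightarrow> bool" where
  "involutive_anti_automorphism \<tau> \<longleftrightarrow>
     (\<forall>x y. \<tau> (x * y) = \<tau> y * \<tau> x) \<and> (\<forall>x. \<tau> (\<tau> x) = x)"

definition multiplicative :: "('m::monoid_mult \<Rightarrow> complex) \<Rightarrow> bool" where
  "multiplicative \<mu> \<longleftrightarrow> (\<forall>x y. \<mu> (x * y) = \<mu> x * \<mu> y)"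

definition abelian :: "('m::monoid_mult \<Rightarrow> complex) \<Rightarrow> bool" where
  "abelian f \<longleftrightarrow>
     (\<forall>n\<ge>2. \<forall>(x :: nat \<Rightarrow> 'm) \<epsilon>. \<epsilon> permutes {1..n} \<longrightarrow>
        f (prod_list (map x [1..<Suc n])) = f (prod_list (map (\<lambda>i. x (\<epsilon> i)) [1..<Suc n])))"

text \<open>
  A representation space of finite dimension \<open>n\<close> is taken to be the coordinate space
  \<^typ>\<open>complex ^ 'n\<close> with \<open>CARD('n) = n\<close>; every complex vector space of dimension \<open>n\<close> is
  isomorphic to it. It is automatically non-zero, because index types are non-empty. Its linear
  operators are the maps that are complex linear, i.e. linear with respect to \<open>(*s)\<close>.
\<close>

definition representation :: "('m::monoid_mult \<Rightarrow> complex ^ 'n \<Rightarrow> complex ^ 'n) \<Rightarrow> bool" where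
  "representation \<pi> \<longleftrightarrow>
     (\<forall>x. Vector_Spaces.linear (*s) (*s) (\<pi> x)) \<and>
     (\<forall>x y. \<pi> (x * y) = \<pi> x \<circ> \<pi> y) \<and> \<pi> 1 = id"

definition irreducible_representation ::
    "('m::monoid_mult \<Rightarrow> complex ^ 'n \<Rightarrow> complex ^ 'n) \<Rightarrow> bool" where
  "irreducible_representation \<pi> \<longleftrightarrow>
     representation \<pi> \<and>
     (\<forall>W. vec.subspace W \<and> (\<forall>x. \<pi> x ` W \<subseteq> W) \<longrightarrow> W = {0} \<or> W = UNIV)"

text \<open>
  Continuity refers to the natural topology of the finite-dimensional space of linear operators,
  here carried by the matrices with respect to the standard basis.
\<close>

definition continuous_representation ::
    "('m::topological_monoid_mult \<Rightarrow> complex ^ 'n \<Rightarrow> complex ^ 'n) \<Rightarrow> bool" where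
  "continuous_representation \<pi> \<longleftrightarrow>
     representation \<pi> \<and> continuous_on UNIV (\<lambda>x. matrix (\<pi> x))"

definition tr :: "(complex ^ 'n \<Rightarrow> complex ^ 'n) \<Rightarrow> complex" where
  "tr A = trace (matrix A)"

definition character :: "('m \<Rightarrow> complex ^ 'n \<Rightarrow> complex ^ 'n) \<Rightarrow> 'm \<Rightarrow> complex" where
  "character \<pi> x = tr (\<pi> x)"

definition adj :: "(complex ^ 2 \<Rightarrow> complex ^ 2) \<Rightarrow> complex ^ 2 \<Rightarrow> complex ^ 2" where
  "adj A = (\<lambda>v. tr A *s v - A v)"

end

theory Submission
  imports Defs "HOL-Library.Poly_Mapping"
begin

text \<open>
  Putting \<open>y = 1\<close> shows \<open>f (x * z\<^sub>0) = f 1 * f x\<close>, so \<open>z\<^sub>0\<close> disappears from the equation once it is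
  written for \<open>g = f / f 1\<close>: \<open>g (x * \<sigma> y) + g (\<tau> y * x) = 2 * g x * g y\<close>. The values of \<open>g\<close> along an
  orbit of the group generated by \<open>\<sigma>\<close> and \<open>\<tau>\<close> form an arithmetic progression, and the quadratic right-hand
  side forbids a non-zero common difference. Hence \<open>g\<close> is invariant under \<open>\<sigma>\<close> and \<open>\<tau>\<close>; it follows that
  \<open>g\<close> is central and solves d'Alembert's equation for the anti-automorphism \<open>\<tau> \<circ> \<sigma>\<close>, and then that it
  satisfies the identity which half the trace satisfies on 2 by 2 matrices
  (\<open>normalized_solution.trace_identity\<close>).

  All of this is multilinear, so the extension of \<open>g\<close> to the monoid algebra is a trace with the same
  identity. Modulo the radical of the form \<open>G (a * b)\<close> every element of such an algebra is a root of a
  quadratic polynomial, as in the Cayley-Hamilton theorem. Over the complex numbers this yields, unless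
  \<open>G\<close> itself is multiplicative, an idempotent \<open>e\<close> with \<open>G e = 1 / 2\<close> such that \<open>e * s * e\<close> is
  always a multiple of \<open>e\<close>. There are two cases.

  If the quotient by the radical is commutative, \<open>\<mu> x = 2 * G (x * e)\<close> is multiplicative and
  \<open>2 * g = \<mu> + \<mu> \<circ> \<sigma> \<circ> \<tau>\<close>. Comparing this with the decomposition of \<open>2 * (g \<circ> \<sigma>) = 2 * g\<close> and
  using that a sum of two multiplicative functions determines its summands gives the parity of \<open>\<mu>\<close>.

  If it is not commutative, the corner \<open>e * s * (1 - e)\<close> is non-zero for some \<open>s\<close>, and \<open>e\<close>
  can be completed to a system of 2 by 2 matrix units (\<open>trace_algebra.ex_frame\<close>). The coordinates with respect to
  these units are a representation with character \<open>2 * g\<close>. It is irreducible because the matrix units lie in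
  the algebra that \<open>M\<close> spans, and it is continuous because its entries are combinations of translates of \<open>g\<close>.

  In either case the value at \<open>z\<^sub>0\<close> and the behaviour under \<open>\<sigma>\<close> and \<open>\<tau>\<close> come from linear relations
  between translates of \<open>g\<close>, which the coordinates inherit (\<open>linear_extension_relation\<close>).
\<close>

section \<open>Algebras with a trace that satisfies the trace identity of 2 by 2 matrices\<close>

text \<open>
  The model is \<open>G a = trace a / 2\<close> on 2 by 2 matrices, where \<open>trace_identity\<close> is the polarized
  Cayley-Hamilton identity \<open>a * b + b * a = 2 * G a * b + 2 * G b * a + 2 * G (a * b) - 4 * G a * G b\<close>
  tested against \<open>c\<close>. The form \<open>G (a * b)\<close> may be degenerate. Instead of passing to the quotient by
  its radical, equations \<open>a = b\<close> in the quotient are expressed below as \<open>G (a * c) = G (b * c)\<close> for all \<open>c\<close>.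
\<close>

locale trace_algebra =
  fixes G :: "'r::ring_1 \<Rightarrow> complex"
    and scale :: "complex \<Rightarrow> 'r \<Rightarrow> 'r"
  assumes G_add: "G (a + b) = G a + G b"
    and G_scale: "G (scale k a) = k * G a"
    and scale_left: "scale k a * b = scale k (a * b)"
    and scale_right: "a * scale k b = scale k (a * b)"
    and G_one: "G 1 = 1"
    and G_commute: "G (a * b) = G (b * a)"
    and trace_identity: "G (a * b * c) + G (b * a * c) =
      2 * G a * G (b * c) + 2 * G b * G (a * c) + 2 * G c * G (a * b) - 4 * G a * G b * G c"
begin

lemma G_diff: "G (a - b) = G a - G b"
  using G_add[of "a - b" b] by simp

lemma G_rotate: "G (a * b * c) = G (c * a * b)"
  using G_commute[of "a * b" c] by (simp add: mult.assoc)

text \<open>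
  Modulo the radical, the premise says \<open>q * q = 2 * G q * q\<close>, i.e. that \<open>q\<close> is singular: its two
  eigenvalues are \<open>0\<close> and its trace. A singular 2 by 2 matrix has rank at most one, whence
  \<open>q * s * q\<close> is a multiple of \<open>q\<close>. Here this is the trace identity for \<open>q\<close>, \<open>s\<close> and \<open>c * q\<close>.
\<close>

lemma sandwich:
  assumes "\<And>c. G (q * q * c) = 2 * G q * G (q * c)"
  shows "G (q * s * q * c) = 2 * G (q * s) * G (q * c)"
proof -
  have "G (q * s * (c * q)) + G (s * q * (c * q)) =
      2 * G q * G (s * (c * q)) + 2 * G s * G (q * (c * q)) + 2 * G (c * q) * G (q * s)
        - 4 * G q * G s * G (c * q)"
    by (rule trace_identity)
  moreover have "G (q * s * (c * q)) = 2 * G q * G (q * s * c)"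
    using assms[of "s * c"] G_commute[of "q * s * c" q] by (simp add: mult.assoc)
  moreover have "G (q * (c * q)) = 2 * G q * G (q * c)"
    using assms[of c] G_commute[of "q * c" q] by (simp add: mult.assoc)
  moreover have "G (s * (c * q)) = G (q * s * c)" "G (c * q) = G (q * c)"
    using G_commute[of "s * c" q] G_commute[of c q] by (simp_all add: mult.assoc)
  moreover have "G (s * q * (c * q)) = G (q * s * q * c)"
    using G_commute[of "s * q * c" q] by (simp add: mult.assoc)
  ultimately show ?thesis
    by (simp add: algebra_simps)
qed

text \<open>
  An idempotent of trace one modulo the radical. For 2 by 2 matrices these are exactly the idempotents of rank one.
\<close>

definition primitive :: "'r \<Rightarrow> bool" where
  "primitive e \<longleftrightarrow> 2 * G e = 1 \<and> (\<forall>c. G (e * e * c) = G (e * c))"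

lemma primitive_sandwich:
  assumes "primitive e"
  shows "G (e * s * e * c) = 2 * G (e * s) * G (e * c)"
  using assms by (intro sandwich) (simp add: primitive_def)

lemma primitive_complement:
  assumes "primitive e"
  shows "primitive (1 - e)"
  using assms by (simp add: primitive_def left_diff_distrib right_diff_distrib G_diff G_one mult.assoc)

text \<open>
  The premise says that \<open>a\<close> is not a scalar modulo the radical. If \<open>l\<close> is an eigenvalue of \<open>a\<close>, then
  \<open>q = a - l\<close> is singular and non-zero. As the form does not vanish on \<open>q\<close>, some \<open>q * s\<close> has trace one
  after scaling, and then \<open>sandwich\<close> makes it idempotent.
\<close>

lemma ex_primitive:
  assumes "G (a * b) \<noteq> G a * G b"
  obtains e where "primitive e"
proof -
  \<comment> \<open>the root of the characteristic polynomial \<open>l\<^sup>2 - 2 * G a * l + det a\<close>, where \<open>det a = 2 * (G a)\<^sup>2 - G (a * a)\<close>\<close>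
  define l where "l = G a + csqrt (G (a * a) - (G a)\<^sup>2)"
  have l: "l * l = 2 * l * G a - 2 * G a * G a + G (a * a)"
    using power2_csqrt[of "G (a * a) - (G a)\<^sup>2"] by (simp add: l_def power2_eq_square algebra_simps)
  define q where "q = a - scale l 1"
  have G_q: "G (q * c) = G (a * c) - l * G c" for c
    by (simp add: q_def left_diff_distrib G_diff G_scale scale_left)
  have q: "G (q * q * c) = 2 * G q * G (q * c)" for c
  proof -
    have "2 * G (a * (a * c)) = 2 * (2 * G a * G (a * c) + G c * G (a * a) - 2 * G a * G a * G c)"
      using trace_identity[of a a c] by (simp add: mult.assoc)
    then have aac: "G (a * (a * c)) = 2 * G a * G (a * c) + G c * G (a * a) - 2 * G a * G a * G c"
      by (simp only: mult_cancel_left) simp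
    have "G (a * (q * c)) = G (a * (a * c)) - l * G (a * c)"
      by (simp add: q_def left_diff_distrib right_diff_distrib G_diff G_scale scale_left scale_right)
    then have qqc: "G (q * q * c) = G (a * (a * c)) - l * G (a * c) - l * (G (a * c) - l * G c)"
      using G_q[of "q * c"] by (simp add: G_q mult.assoc)
    have G_q': "G q = G a - l"
      using G_q[of 1] by (simp add: G_one)
    have "G (q * q * c) - 2 * G q * G (q * c) =
        G (a * (a * c)) - l * G (a * c) - l * (G (a * c) - l * G c)
          - 2 * (G a - l) * (G (a * c) - l * G c)"
      by (simp only: qqc G_q' G_q)
    also have "\<dots> = (2 * l * G a - 2 * G a * G a + G (a * a) - l * l) * G c"
      by (simp add: aac algebra_simps)
    finally have "G (q * q * c) - 2 * G q * G (q * c) =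
        (2 * l * G a - 2 * G a * G a + G (a * a) - l * l) * G c" .
    then show ?thesis
      by (simp add: l)
  qed
  have "\<exists>s. G (q * s) \<noteq> 0"
  proof (rule ccontr)
    assume "\<not> (\<exists>s. G (q * s) \<noteq> 0)"
    then have "G (a * c) = l * G c" for c
      using G_q[of c] by simp
    from this[of b] this[of 1] show False
      using assms by (simp add: G_one)
  qed
  then obtain s where s: "G (q * s) \<noteq> 0"
    by blast
  define e where "e = scale (1 / (2 * G (q * s))) (q * s)"
  have "primitive e"
    using s sandwich[OF q, of s "s * c" for c]
    by (simp add: primitive_def e_def G_scale scale_left scale_right mult.assoc)
  then show thesis
    by (rule that)
qed

text \<open>Under commutativity \<open>a * e = e * a * e\<close> is a multiple of \<open>e\<close>, and the factor is multiplicative in \<open>a\<close>.\<close>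

lemma commutative_primitive_multiplicative:
  assumes "primitive e" and "\<And>a b c. G (a * b * c) = G (b * a * c)"
  shows "2 * G (a * b * e) = (2 * G (a * e)) * (2 * G (b * e))"
proof -
  have "G (a * b * e) = G (e * e * (a * b))"
    using assms(1) G_commute[of "a * b" e] by (simp add: primitive_def)
  also have "\<dots> = G (e * a * e * b)"
    using assms(2)[of e "e * a" b] by (simp add: mult.assoc)
  also have "\<dots> = 2 * G (a * e) * G (b * e)"
    using primitive_sandwich[OF assms(1)] by (simp add: G_commute)
  finally show ?thesis
    by simp
qed

text \<open>
  If both off-diagonal Peirce corners of \<open>e\<close> lay in the radical, then every \<open>x\<close> would equal
  \<open>e * x * e + (1 - e) * x * (1 - e)\<close>, a combination of \<open>e\<close> and \<open>1 - e\<close>, and the quotient would be commutative.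
  One corner suffices, since \<open>G\<close> pairs the two corners with each other.
\<close>

lemma ex_off_diagonal:
  assumes e: "primitive e" and noncomm: "G (a * b * c) \<noteq> G (b * a * c)"
  obtains s t where "2 * G (e * s * (1 - e) * t) = 1"
proof -
  have "\<exists>s t. G (e * s * (1 - e) * t) \<noteq> 0"
  proof (rule ccontr)
    assume "\<not> (\<exists>s t. G (e * s * (1 - e) * t) \<noteq> 0)"
    then have zero: "G (e * s * (1 - e) * t) = 0" for s t
      by blast
    have zero': "G ((1 - e) * s * e * t) = 0" for s t
      using zero[of t s] G_commute[of "(1 - e) * s" "e * t"] by (simp add: mult.assoc)
    have e': "primitive (1 - e)"
      using e by (rule primitive_complement)
    have diag: "G (x * y * c) = 4 * G (e * x) * G (e * y) * G (e * c)
        + 4 * G ((1 - e) * x) * G ((1 - e) * y) * G ((1 - e) * c)" for x y c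
    proof -
      have e_part: "G (e * x * y) = 2 * G (e * x) * G (e * y)" for x y
        using zero[of x y] primitive_sandwich[OF e, of x y]
        by (simp add: left_diff_distrib right_diff_distrib G_diff mult.assoc)
      have e'_part: "G ((1 - e) * x * y) = 2 * G ((1 - e) * x) * G ((1 - e) * y)" for x y
      proof -
        have "G ((1 - e) * x * y) = G ((1 - e) * x * e * y) + G ((1 - e) * x * (1 - e) * y)"
          using G_add[of "(1 - e) * x * e * y" "(1 - e) * x * (1 - e) * y"]
          by (simp add: algebra_simps)
        then show ?thesis
          by (simp add: zero' primitive_sandwich[OF e'])
      qed
      have "G (x * y * c) = G (e * (x * y) * c) + G ((1 - e) * (x * y) * c)"
        by (simp add: left_diff_distrib G_diff mult.assoc)
      then show ?thesis
        using e_part[of x "y * c"] e_part[of y c] e'_part[of x "y * c"] e'_part[of y c]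
        by (simp add: mult.assoc)
    qed
    show False
      using noncomm diag[of a b c] diag[of b a c] by simp
  qed
  then obtain s t where "G (e * s * (1 - e) * t) \<noteq> 0"
    by blast
  then have "2 * G (e * s * (1 - e) * scale (1 / (2 * G (e * s * (1 - e) * t))) t) = 1"
    by (simp add: scale_right G_scale)
  then show thesis
    by (rule that)
qed

text \<open>
  Modulo the radical, \<open>C i * R j\<close> is the matrix unit with a one in place \<open>(i, j)\<close>. The first condition
  says that all \<open>R i\<close> lie in the right ideal of one primitive idempotent, with \<open>sandwich\<close> built in; the second
  that the diagonal units sum to one; the third that rows and columns are dual under the trace.
\<close>

definition frame :: "(2 \<Rightarrow> 'r) \<Rightarrow> (2 \<Rightarrow> 'r) \<Rightarrow> bool" where
  "frame R C \<longleftrightarrow>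
     (\<forall>i j x y. G (R i * x * R j * y) = 2 * G (R i * x) * G (R j * y)) \<and>
     (\<forall>x. G (C 1 * R 1 * x) + G (C 2 * R 2 * x) = G x) \<and>
     (\<forall>i j. 2 * G (R i * C j) = (if i = j then 1 else 0))"

text \<open>
  In matrix terms \<open>R 1 = e\<close> is the unit at \<open>(1, 1)\<close>, and \<open>R 2 = e * s * (1 - e)\<close> serves as the unit at
  \<open>(1, 2)\<close>. The scaling of \<open>t\<close> makes \<open>(1 - e) * t * R 2\<close> equal to \<open>1 - e\<close> modulo the radical.
\<close>

lemma ex_frame:
  assumes noncomm: "G (a * b * c) \<noteq> G (b * a * c)"
  obtains R C where "frame R C"
proof -
  have "\<exists>a b. G (a * b) \<noteq> G a * G b"
  proof (rule ccontr)
    assume "\<not> ?thesis"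
    then show False
      using noncomm by simp
  qed
  then obtain e where e: "primitive e"
    using ex_primitive by blast
  obtain s t where st: "2 * G (e * s * (1 - e) * t) = 1"
    using ex_off_diagonal[OF e noncomm] .
  have e': "primitive (1 - e)"
    using e by (rule primitive_complement)
  have idem: "G (e * (e * x)) = G (e * x)" for x
    using e by (simp add: primitive_def mult.assoc)
  have idem': "G ((1 - e) * ((1 - e) * x)) = G ((1 - e) * x)" for x
    using e' by (simp add: primitive_def mult.assoc)
  have orth: "G (e * ((1 - e) * x)) = 0" "G ((1 - e) * (e * x)) = 0" for x
    using idem[of x] by (simp_all add: left_diff_distrib right_diff_distrib G_diff)
  define R C where "R = (\<lambda>i::2. if i = 1 then e else e * s * (1 - e))"
    and "C = (\<lambda>i::2. if i = 1 then 1 else (1 - e) * t)"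
  have "frame R C"
    unfolding frame_def
  proof (intro conjI allI)
    fix i j :: 2 and x y
    define r where "r = (\<lambda>i::2. if i = 1 then 1 else s * (1 - e))"
    have R: "R i = e * r i" for i
      by (simp add: R_def r_def mult.assoc)
    show "G (R i * x * R j * y) = 2 * G (R i * x) * G (R j * y)"
      using primitive_sandwich[OF e, of "r i * x" "r j * y"] by (simp add: R mult.assoc)
  next
    fix x
    have "2 * G ((1 - e) * (t * e * s)) = 1"
      using st G_commute[of "e * s" "(1 - e) * t"] by (simp add: mult.assoc)
    then have "G ((1 - e) * (t * e * s) * (1 - e) * x) = G ((1 - e) * x)"
      using primitive_sandwich[OF e', of "t * e * s" x] by simp
    then show "G (C 1 * R 1 * x) + G (C 2 * R 2 * x) = G x"
      by (simp add: R_def C_def mult.assoc) (simp add: left_diff_distrib G_diff)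
  next
    fix i j :: 2
    have "G (e * s * (1 - e)) = 0"
      using G_commute[of "e * s" "1 - e"] orth(2)[of s] by (simp add: mult.assoc)
    moreover have "G (e * (s * ((1 - e) * ((1 - e) * t)))) = G (e * s * (1 - e) * t)"
      using idem'[of "t * (e * s)"] G_commute[of "(1 - e) * ((1 - e) * t)" "e * s"]
        G_commute[of "(1 - e) * t" "e * s"] by (simp add: mult.assoc)
    ultimately show "2 * G (R i * C j) = (if i = j then 1 else 0)"
      using e st orth(1)[of t] exhaust_2[of i] exhaust_2[of j]
      by (auto simp: R_def C_def primitive_def mult.assoc)
  qed
  then show thesis
    by (rule that)
qed

text \<open>The coordinates of \<open>a\<close> with respect to the matrix units \<open>C i * R j\<close>, read off with the trace form.\<close>

definition frame_matrix :: "(2 \<Rightarrow> 'r) \<Rightarrow> (2 \<Rightarrow> 'r) \<Rightarrow> 'r \<Rightarrow> complex ^ 2 ^ 2" where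
  "frame_matrix R C a = (\<chi> i j. 2 * G (R i * a * C j))"

lemma frame_matrix_one:
  assumes "frame R C"
  shows "frame_matrix R C 1 = mat 1"
  using assms by (simp add: frame_def frame_matrix_def mat_def vec_eq_iff)

lemma frame_matrix_mult:
  assumes "frame R C"
  shows "frame_matrix R C (a * b) = frame_matrix R C a ** frame_matrix R C b"
proof -
  have "2 * G (R i * (a * b) * C j) =
      (2 * G (R i * a * C 1)) * (2 * G (R 1 * b * C j)) +
      (2 * G (R i * a * C 2)) * (2 * G (R 2 * b * C j))" for i j
  proof -
    have "G (R i * (a * b) * C j) = G (b * C j * R i * a)"
      using G_commute[of "R i * a" "b * C j"] by (simp add: mult.assoc)
    also have "\<dots> = G (C 1 * R 1 * (b * C j * R i * a)) + G (C 2 * R 2 * (b * C j * R i * a))"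
      using assms by (simp add: frame_def)
    also have "\<dots> = G (R i * (a * C 1) * R 1 * (b * C j)) + G (R i * (a * C 2) * R 2 * (b * C j))"
      using G_commute[of "C k * R k * (b * C j)" "R i * a" for k] by (simp add: mult.assoc)
    also have "\<dots> = 2 * G (R i * (a * C 1)) * G (R 1 * (b * C j))
        + 2 * G (R i * (a * C 2)) * G (R 2 * (b * C j))"
      using assms by (simp add: frame_def)
    finally show ?thesis
      by (simp add: mult.assoc algebra_simps)
  qed
  then show ?thesis
    by (simp add: frame_matrix_def vec_eq_iff matrix_matrix_mult_def sum_2)
qed

lemma frame_matrix_unit:
  assumes "frame R C"
  shows "frame_matrix R C (C k * R l) $ i $ j = (if i = k \<and> j = l then 1 else 0)"
proof -
  have "2 * G (R i * (C k * R l) * C j) = (2 * G (R i * C k)) * (2 * G (R l * C j))"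
    using assms by (simp add: frame_def flip: mult.assoc)
  also have "\<dots> = (if i = k then 1 else 0) * (if l = j then 1 else 0)"
    using assms by (simp add: frame_def)
  finally show ?thesis
    by (simp add: frame_matrix_def)
qed

lemma trace_frame_matrix:
  assumes "frame R C"
  shows "trace (frame_matrix R C a) = 2 * G a"
proof -
  have "G (R i * a * C i) = G (C i * R i * a)" for i
    by (rule G_rotate)
  then show ?thesis
    using assms by (simp add: frame_def frame_matrix_def trace_def sum_2 flip: distrib_left)
qed

end

section \<open>The monoid algebra and linear extension\<close>

text \<open>
  A finitely supported function type carries the convolution product when its index type is an additive, possibly
  non-commutative, monoid. The wrapper turns a multiplicative monoid into such an index type.
\<close>

datatype 'm additive = Additive (unadd: 'm)

instantiation additive :: (monoid_mult) monoid_add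
begin

definition "0 = Additive 1"

definition "a + b = Additive (unadd a * unadd b)"

instance
  by standard (simp_all add: zero_additive_def plus_additive_def mult.assoc)

end

type_synonym 'm monoid_algebra = "'m additive \<Rightarrow>\<^sub>0 complex"

definition basis :: "'m \<Rightarrow> 'm monoid_algebra" where
  "basis x = Poly_Mapping.single (Additive x) 1"

definition scale :: "complex \<Rightarrow> 'm::monoid_mult monoid_algebra \<Rightarrow> 'm monoid_algebra" where
  "scale k a = Poly_Mapping.single 0 k * a"

lemma basis_mult: "basis (x * y) = basis x * basis y"
  by (simp add: basis_def mult_single plus_additive_def)

lemma basis_one: "basis 1 = 1"
  by (simp add: basis_def flip: zero_additive_def)

lemma monoid_algebra_induct [case_names scaled_basis add]:
  fixes a :: "'m::monoid_mult monoid_algebra"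
  assumes scaled_basis: "\<And>k x. P (scale k (basis x))"
    and add: "\<And>a b. P a \<Longrightarrow> P b \<Longrightarrow> P (a + b)"
  shows "P a"
proof -
  have single: "P (Poly_Mapping.single x k)" for x k
    using scaled_basis[of k "unadd x"]
    by (simp add: scale_def basis_def mult_single)
  show ?thesis
  proof (induction a rule: Poly_Mapping.update_induct)
    case const
    then show ?case
      using single[of 0 0] by simp
  next
    case (update a x k)
    have "Poly_Mapping.update x k a = a + Poly_Mapping.single x k"
      using update.hyps
      by (intro poly_mapping_eqI) (auto simp: lookup_update lookup_add lookup_single when_def in_keys_iff)
    then show ?case
      using update single add by simp
  qed
qed

definition linear_extension :: "('m \<Rightarrow> complex) \<Rightarrow> 'm monoid_algebra \<Rightarrow> complex" where
  "linear_extension g a = (\<Sum>x\<in>Poly_Mapping.keys a. Poly_Mapping.lookup a x * g (unadd x))"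

lemma linear_extension_add:
  "linear_extension g (a + b) = linear_extension g a + linear_extension g b"
proof -
  let ?K = "Poly_Mapping.keys a \<union> Poly_Mapping.keys b"
  have superset: "linear_extension g c = (\<Sum>x\<in>?K. Poly_Mapping.lookup c x * g (unadd x))"
    if "Poly_Mapping.keys c \<subseteq> ?K" for c
    unfolding linear_extension_def
    by (rule sum.mono_neutral_left) (use that in \<open>auto simp: in_keys_iff\<close>)
  show ?thesis
    using Poly_Mapping.keys_add[of a b]
    by (simp add: superset lookup_add distrib_right sum.distrib)
qed

lemma linear_extension_basis: "linear_extension g (basis x) = g x"
  by (simp add: linear_extension_def basis_def)

lemma linear_extension_scale:
  fixes a :: "'m::monoid_mult monoid_algebra"
  shows "linear_extension g (scale k a) = k * linear_extension g a"
proof (induction a rule: monoid_algebra_induct)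
  case (scaled_basis l x)
  show ?case
    by (simp add: linear_extension_def basis_def scale_def mult_single)
next
  case (add a b)
  then show ?case
    by (simp add: scale_def distrib_left linear_extension_add)
qed

lemma scale_mult_left: "scale k a * b = scale k (a * b)"
  by (simp add: scale_def mult.assoc)

lemma scale_mult_right: "a * scale k b = scale k (a * b)"
proof -
  have "a * Poly_Mapping.single 0 k = Poly_Mapping.single 0 k * a"
  proof (induction a rule: monoid_algebra_induct)
    case (scaled_basis l x)
    show ?case
      by (simp add: scale_def basis_def mult_single mult.commute)
  next
    case (add a b)
    then show ?case
      by (simp add: distrib_left distrib_right)
  qed
  then show ?thesis
    by (simp add: scale_def flip: mult.assoc)
qed

lemma trace_algebra_linear_extension:
  fixes g :: "'m::monoid_mult \<Rightarrow> complex"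
  assumes one: "g 1 = 1"
    and central: "\<And>x y. g (x * y) = g (y * x)"
    and trace_identity: "\<And>x y w. g (x * y * w) + g (y * x * w) =
      2 * g x * g (y * w) + 2 * g y * g (x * w) + 2 * g w * g (x * y) - 4 * g x * g y * g w"
  shows "trace_algebra (linear_extension g) scale"
proof
  fix a b c :: "'m monoid_algebra" and k
  note simps = linear_extension_add linear_extension_scale scale_mult_left scale_mult_right
    distrib_left distrib_right
  show "linear_extension g (a + b) = linear_extension g a + linear_extension g b"
    by (rule linear_extension_add)
  show "linear_extension g (scale k a) = k * linear_extension g a"
    by (rule linear_extension_scale)
  show "scale k a * b = scale k (a * b)" "a * scale k b = scale k (a * b)"
    by (rule scale_mult_left scale_mult_right)+
  show "linear_extension g 1 = 1"
    using linear_extension_basis[of g 1] by (simp add: basis_one one)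
  show "linear_extension g (a * b) = linear_extension g (b * a)"
  proof (induction a rule: monoid_algebra_induct)
    case (scaled_basis k x)
    show ?case
    proof (induction b rule: monoid_algebra_induct)
      case (scaled_basis l y)
      show ?case
        using central[of x y] by (simp add: simps linear_extension_basis flip: basis_mult)
    qed (auto simp: simps)
  qed (auto simp: simps)
  let ?identity = "\<lambda>a b c. linear_extension g (a * b * c) + linear_extension g (b * a * c) =
      2 * linear_extension g a * linear_extension g (b * c)
      + 2 * linear_extension g b * linear_extension g (a * c)
      + 2 * linear_extension g c * linear_extension g (a * b)
      - 4 * linear_extension g a * linear_extension g b * linear_extension g c"
  show "?identity a b c"
  proof (induction a rule: monoid_algebra_induct)
    case (scaled_basis k x)
    show ?case
    proof (induction b rule: monoid_algebra_induct)
      case (scaled_basis l y)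
      show ?case
      proof (induction c rule: monoid_algebra_induct)
        case (scaled_basis m w)
        have "?identity (scale k (basis x)) (scale l (basis y)) (scale m (basis w)) \<longleftrightarrow>
            k * l * m * (g (x * y * w) + g (y * x * w)) = k * l * m * (2 * g x * g (y * w)
              + 2 * g y * g (x * w) + 2 * g w * g (x * y) - 4 * g x * g y * g w)"
          by (simp add: simps linear_extension_basis algebra_simps flip: basis_mult)
        then show ?case
          by (simp only: trace_identity)
      next
        case (add c d)
        show ?case
          using arg_cong2[of _ _ _ _ "(+)", OF add.IH]
          by (simp add: simps algebra_simps)
      qed
    next
      case (add b d)
      show ?case
        using arg_cong2[of _ _ _ _ "(+)", OF add.IH]
        by (simp add: simps algebra_simps)
    qed
  next
    case (add a d)
    show ?case
      using arg_cong2[of _ _ _ _ "(+)", OF add.IH]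
      by (simp add: simps algebra_simps)
  qed
qed

text \<open>
  A relation \<open>x = k + l * y\<close> that holds when tested against all elements of the monoid holds when tested against
  the whole algebra, i.e. modulo the radical. It is applied to \<open>z\<^sub>0\<close>, which acts as a scalar, and to \<open>\<tau> (\<sigma> x) = 2 * g x - x\<close>.
\<close>

lemma linear_extension_relation:
  fixes g :: "'m::monoid_mult \<Rightarrow> complex"
  assumes "\<And>w. g (x * w) = k * g w + l * g (y * w)"
  shows "linear_extension g (basis x * a) =
    k * linear_extension g a + l * linear_extension g (basis y * a)"
proof (induction a rule: monoid_algebra_induct)
  case (scaled_basis m w)
  show ?case
    using assms[of w]
    by (simp add: scale_mult_right linear_extension_scale linear_extension_basis algebra_simps
        flip: basis_mult)
next
  case (add a b)
  then show ?case
    by (simp add: distrib_left linear_extension_add)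
qed

lemma continuous_on_linear_extension:
  fixes g :: "'m::topological_monoid_mult \<Rightarrow> complex"
  assumes "continuous_on UNIV g"
  shows "continuous_on UNIV (\<lambda>x. linear_extension g (basis x * a))"
proof (induction a rule: monoid_algebra_induct)
  case (scaled_basis k w)
  have "continuous_on UNIV (\<lambda>x. g (x * w))"
    by (rule continuous_on_compose2[OF assms]) (auto intro!: continuous_intros)
  then show ?case
    by (simp add: scale_mult_right linear_extension_scale linear_extension_basis continuous_intros
        flip: basis_mult)
next
  case (add a b)
  then show ?case
    by (simp add: distrib_left linear_extension_add continuous_intros)
qed

section \<open>The normalized functional equation\<close>

locale normalized_solution =
  fixes \<sigma> \<tau> :: "'m::monoid_mult \<Rightarrow> 'm" and g :: "'m \<Rightarrow> complex"
  assumes \<sigma>: "involutive_automorphism \<sigma>"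
    and \<tau>: "involutive_anti_automorphism \<tau>"
    and one: "g 1 = 1"
    and equation: "g (x * \<sigma> y) + g (\<tau> y * x) = 2 * g x * g y"
begin

lemma \<sigma>_simps [simp]: "\<sigma> (x * y) = \<sigma> x * \<sigma> y" "\<sigma> (\<sigma> x) = x"
  using \<sigma> by (simp_all add: involutive_automorphism_def)

lemma \<tau>_simps [simp]: "\<tau> (x * y) = \<tau> y * \<tau> x" "\<tau> (\<tau> x) = x"
  using \<tau> by (simp_all add: involutive_anti_automorphism_def)

text \<open>
  With \<open>x = 1\<close> the equation says that \<open>g y\<close> is the mean of \<open>g (\<sigma> y)\<close> and \<open>g (\<tau> y)\<close>. So the values of
  \<open>g\<close> along \<open>\<dots>, \<sigma> (\<tau> y), \<tau> y, y, \<sigma> y, \<tau> (\<sigma> y), \<dots>\<close> form an arithmetic progression, with difference \<open>d y\<close>.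
  Four steps along it, in either direction, are the mutually inverse automorphisms \<open>\<alpha>\<close> and \<open>\<beta>\<close>. Moving \<open>x\<close>
  by one and \<open>y\<close> by the other changes both terms on the left of the equation affinely in the number of moves, but the
  right-hand side quadratically with leading coefficient proportional to \<open>d x * d y\<close>. A second difference at \<open>y = x\<close>
  gives \<open>d x = 0\<close>.
\<close>

lemma \<sigma>_invariant [simp]: "g (\<sigma> x) = g x"
proof -
  define d where "d x = g (\<sigma> x) - g x" for x
  define \<alpha> \<beta> where "\<alpha> x = \<tau> (\<sigma> (\<tau> (\<sigma> x)))" and "\<beta> x = \<sigma> (\<tau> (\<sigma> (\<tau> x)))" for x
  have mean: "g (\<tau> x) = 2 * g x - g (\<sigma> x)" for x
    using equation[of 1 x] by (simp add: one algebra_simps)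
  have mean': "g (\<sigma> x) = 2 * g x - g (\<tau> x)" for x
    using mean[of x] by simp
  have \<alpha>: "g (\<alpha> x) = g x + 4 * d x" for x
    unfolding \<alpha>_def d_def
    using mean[of "\<sigma> (\<tau> (\<sigma> x))"] mean'[of "\<tau> (\<sigma> x)"] mean[of "\<sigma> x"]
    by (simp add: algebra_simps)
  have \<beta>: "g (\<beta> x) = g x - 4 * d x" for x
    unfolding \<beta>_def d_def
    using mean'[of "\<tau> (\<sigma> (\<tau> x))"] mean[of "\<sigma> (\<tau> x)"] mean'[of "\<tau> x"] mean[of x]
    by (simp add: algebra_simps)
  have *: "\<alpha> x * \<sigma> (\<beta> y) = \<alpha> (x * \<sigma> y)" "\<tau> (\<beta> y) * \<alpha> x = \<alpha> (\<tau> y * x)"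
    "\<beta> x * \<sigma> (\<alpha> y) = \<beta> (x * \<sigma> y)" "\<tau> (\<alpha> y) * \<beta> x = \<beta> (\<tau> y * x)" for x y
    by (simp_all add: \<alpha>_def \<beta>_def)
  have eq1: "g (\<alpha> (x * \<sigma> x)) + g (\<alpha> (\<tau> x * x)) = 2 * g (\<alpha> x) * g (\<beta> x)"
    using equation[of "\<alpha> x" "\<beta> x"] by (simp only: *)
  have eq2: "g (\<beta> (x * \<sigma> x)) + g (\<beta> (\<tau> x * x)) = 2 * g (\<beta> x) * g (\<alpha> x)"
    using equation[of "\<beta> x" "\<alpha> x"] by (simp only: *)
  have "2 * (g (x * \<sigma> x) + g (\<tau> x * x)) = 4 * g (\<alpha> x) * g (\<beta> x)"
    using arg_cong2[of _ _ _ _ "(+)", OF eq1 eq2] unfolding \<alpha>[of "_ * _"] \<beta>[of "_ * _"]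
    by (simp add: algebra_simps)
  then have "d x * d x = 0"
    unfolding equation \<alpha> \<beta> by (simp add: algebra_simps)
  then show ?thesis
    by (simp add: d_def)
qed

lemma \<tau>_invariant [simp]: "g (\<tau> x) = g x"
  using equation[of 1 x] by (simp add: one)

text \<open>
  Exchanging the two variables and applying the invariance of \<open>g\<close> turns \<open>g (x * y)\<close> into \<open>g (y * x)\<close> and leaves the
  other term and the right-hand side fixed; this is centrality.
\<close>

lemma dAlembert: "g (x * y) + g (x * \<tau> (\<sigma> y)) = 2 * g x * g y"
  and central: "g (x * y) = g (y * x)"
proof -
  have right: "g (x * y) + g (\<tau> (\<sigma> y) * x) = 2 * g x * g y" for x y
    using equation[of x "\<sigma> y"] by simp
  have left: "g (y * x) + g (\<tau> (\<sigma> y) * x) = 2 * g x * g y" for x y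
    using equation[of "\<sigma> y" x] \<tau>_invariant[of "\<tau> (\<sigma> y) * x"] \<sigma>_invariant[of "y * x"]
    by simp
  have central: "g (x * y) = g (y * x)" for x y
    using left[of y x] right[of x y] by (metis add_right_cancel)
  then show "g (x * y) = g (y * x)" .
  show "g (x * y) + g (x * \<tau> (\<sigma> y)) = 2 * g x * g y"
    using right[of x y] central[of x] by simp
qed

lemma \<tau>\<sigma>_relation: "g (\<tau> (\<sigma> x) * w) = 2 * g x * g w + (- 1) * g (x * w)"
  using dAlembert[of w x] central[of w] by (simp add: algebra_simps)

lemma \<sigma>\<tau>_relation: "g (\<sigma> (\<tau> x) * w) = 2 * g x * g w + (- 1) * g (x * w)"
proof -
  have "g (\<sigma> (\<tau> x) * w) + g (x * w) = 2 * g (\<tau> x) * g w"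
    using \<tau>\<sigma>_relation[of "\<sigma> (\<tau> x)" w] by (simp add: algebra_simps)
  then show ?thesis
    by (simp add: algebra_simps)
qed

text \<open>
  Expand \<open>g (w * \<rho> (x * y))\<close> for the anti-automorphism \<open>\<rho> = \<tau> \<circ> \<sigma>\<close> in two ways: by d'Alembert's equation for
  the element \<open>x * y\<close>, and, as \<open>\<rho> (x * y) = \<rho> y * \<rho> x\<close>, by using the equation for \<open>x\<close> and \<open>y\<close> in turn.
\<close>

lemma trace_identity: "g (x * y * w) + g (y * x * w) =
  2 * g x * g (y * w) + 2 * g y * g (x * w) + 2 * g w * g (x * y) - 4 * g x * g y * g w"
proof -
  define \<rho> where "\<rho> x = \<tau> (\<sigma> x)" for x
  have \<rho>: "g (v * \<rho> u) = 2 * g u * g v - g (v * u)" for u v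
    using dAlembert[of v u] by (simp add: \<rho>_def algebra_simps)
  have "g (w * \<rho> (x * y)) = g (w * \<rho> y * \<rho> x)"
    by (simp add: \<rho>_def mult.assoc)
  also have "\<dots> = 2 * g x * g (w * \<rho> y) - g (x * w * \<rho> y)"
    using \<rho>[of "w * \<rho> y" x] central[of "w * \<rho> y" x] by (simp only: mult.assoc)
  finally have "2 * g (x * y) * g w - g (w * (x * y)) =
      2 * g x * (2 * g y * g w - g (w * y)) - (2 * g y * g (x * w) - g (x * w * y))"
    by (simp only: \<rho>)
  moreover have "g (w * (x * y)) = g (x * y * w)" "g (w * y) = g (y * w)"
    "g (x * w * y) = g (y * x * w)"
    using central[of w] central[of "x * w" y] by (simp_all add: mult.assoc)
  ultimately show ?thesis
    by (simp add: algebra_simps)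
qed

end

section \<open>Abelian functions\<close>

text \<open>
  As \<open>x\<close> and \<open>y\<close> are arbitrary elements, the premise moves a factor past a whole product at once. The prefix \<open>u\<close>
  absorbs the factors that are already in place.
\<close>

lemma permutation_invariant:
  fixes f :: "'m::monoid_mult \<Rightarrow> 'b"
  assumes "\<And>u x y w. f (u * (x * y) * w) = f (u * (y * x) * w)"
  shows "mset xs = mset ys \<Longrightarrow> f (u * prod_list xs) = f (u * prod_list ys)"
proof (induction xs arbitrary: u ys)
  case Nil
  then show ?case
    by simp
next
  case (Cons x xs)
  then have "x \<in> set ys"
    by (metis list.set_intros(1) set_mset_mset)
  then obtain as bs where ys: "ys = as @ x # bs"
    by (meson split_list)
  then have "mset xs = mset (as @ bs)"
    using Cons.prems by simp
  then have "f (u * x * prod_list xs) = f (u * x * prod_list (as @ bs))"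
    by (rule Cons.IH)
  also have "\<dots> = f (u * prod_list ys)"
    using assms[of u x "prod_list as" "prod_list bs"] by (simp add: ys mult.assoc)
  finally show ?case
    by (simp add: mult.assoc)
qed

lemma abelian_iff:
  fixes f :: "'m::monoid_mult \<Rightarrow> complex"
  assumes central: "\<And>x y. f (x * y) = f (y * x)"
  shows "abelian f \<longleftrightarrow> (\<forall>x y w. f (x * y * w) = f (y * x * w))"
proof
  assume "abelian f"
  show "\<forall>x y w. f (x * y * w) = f (y * x * w)"
  proof (intro allI)
    fix x y w :: 'm
    define z where "z = (\<lambda>i::nat. if i = 1 then x else if i = 2 then y else w)"
    have "Transposition.transpose 1 2 permutes {1..3::nat}"
      by (rule permutes_swap_id) auto
    then have "f (prod_list (map z [1..<Suc 3])) =
        f (prod_list (map (\<lambda>i. z (Transposition.transpose 1 2 i)) [1..<Suc 3]))"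
      using \<open>abelian f\<close>[unfolded abelian_def, THEN spec[where x = 3], THEN mp,
          THEN spec[where x = z], THEN spec[where x = "Transposition.transpose 1 2"], THEN mp]
      by (simp del: upt_Suc)
    then show "f (x * y * w) = f (y * x * w)"
      by (simp add: z_def Transposition.transpose_def upt_rec mult.assoc)
  qed
next
  assume comm: "\<forall>x y w. f (x * y * w) = f (y * x * w)"
  have swap: "f (u * (x * y) * w) = f (u * (y * x) * w)" for u x y w
    using comm[rule_format, of x y "w * u"] central[of u "x * y * w"] central[of u "y * x * w"]
    by (simp add: mult.assoc)
  show "abelian f"
    unfolding abelian_def
  proof (intro allI impI)
    fix n :: nat and z :: "nat \<Rightarrow> 'm" and \<epsilon>
    assume "\<epsilon> permutes {1..n}"
    then have "image_mset \<epsilon> (mset [1..<Suc n]) = mset [1..<Suc n]"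
      unfolding mset_upt atLeastLessThanSuc_atLeastAtMost by (rule permutes_image_mset)
    then have "image_mset z (mset [1..<Suc n]) = image_mset z (image_mset \<epsilon> (mset [1..<Suc n]))"
      by (simp only:)
    then have "mset (map z [1..<Suc n]) = mset (map (\<lambda>i. z (\<epsilon> i)) [1..<Suc n])"
      by (simp only: mset_map multiset.map_comp comp_def)
    from permutation_invariant[where f = f and u = 1, OF swap this]
    show "f (prod_list (map z [1..<Suc n])) = f (prod_list (map (\<lambda>i. z (\<epsilon> i)) [1..<Suc n]))"
      by simp
  qed
qed

section \<open>Sums of two multiplicative functions\<close>

text \<open>
  Comparing the sums at \<open>y\<close> and \<open>y * y\<close> shows that \<open>v y\<close> is one of \<open>u y\<close> and \<open>u' y\<close>. If \<open>v y\<close> differs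
  from \<open>u' y\<close> for a single \<open>y\<close>, comparing the sums at all \<open>x * y\<close> forces \<open>v = u\<close>.
\<close>

lemma multiplicative_sum_unique:
  assumes mult: "multiplicative u" "multiplicative u'" "multiplicative v" "multiplicative v'"
    and sum: "\<And>x. u x + u' x = v x + v' x"
  shows "v = u \<or> v = u'"
proof (cases "v = u'")
  case False
  then obtain y where y: "v y \<noteq> u' y"
    by blast
  have v': "v' x = u x + u' x - v x" for x
    using sum[of x] by simp
  have eq: "u x * u y + u' x * u' y = v x * v y + v' x * v' y" for x y
    using mult sum[of "x * y"] by (simp add: multiplicative_def)
  have "2 * ((v y - u y) * (v y - u' y)) = 0"
    using eq[of y y] unfolding v' by (simp add: algebra_simps)
  then have vy: "v y = u y"
    using y by simp
  have "(u x - v x) * (v y - u' y) = 0" for x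
    using eq[of x y] unfolding v' by (simp add: vy algebra_simps)
  then have "v = u"
    using y by (auto simp: fun_eq_iff)
  then show ?thesis ..
qed simp

section \<open>The two kinds of solutions\<close>

context normalized_solution
begin

lemma trace_algebra: "trace_algebra (linear_extension g) scale"
  using one central trace_identity by (rule trace_algebra_linear_extension)

text \<open>
  The element \<open>a\<close> is a primitive idempotent if there is one. Otherwise the linear extension of \<open>g\<close> is itself
  multiplicative, and \<open>a = 1 / 2\<close> makes the function below equal to \<open>g\<close>.
\<close>

lemma commutative_solution:
  assumes comm: "\<And>x y w. g (x * y * w) = g (y * x * w)"
  obtains a where "2 * linear_extension g a = 1"
    and "multiplicative (\<lambda>x. 2 * linear_extension g (basis x * a))"
proof -
  interpret A: trace_algebra "linear_extension g" scale
    by (rule trace_algebra)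
  show thesis
  proof (cases "\<forall>a b. linear_extension g (a * b) = linear_extension g a * linear_extension g b")
    case True
    show thesis
    proof (rule that[of "scale (1 / 2) 1"])
      show "multiplicative (\<lambda>x. 2 * linear_extension g (basis x * scale (1 / 2) 1))"
        using True by (simp add: multiplicative_def A.scale_right A.G_scale basis_mult)
    qed (simp add: A.G_scale A.G_one)
  next
    case False
    then obtain e where e: "A.primitive e"
      using A.ex_primitive by blast
    have comm': "linear_extension g (a * b * c) = linear_extension g (b * a * c)" for a b c
    proof (induction a rule: monoid_algebra_induct)
      case (scaled_basis k x)
      show ?case
      proof (induction b rule: monoid_algebra_induct)
        case (scaled_basis l y)
        show ?case
        proof (induction c rule: monoid_algebra_induct)
          case (scaled_basis m w)
          show ?case
            using comm[of x y w]
            by (simp add: A.scale_left A.scale_right A.G_scale linear_extension_basis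
                flip: basis_mult)
        qed (simp add: distrib_left linear_extension_add)
      qed (simp add: distrib_left distrib_right linear_extension_add)
    qed (simp add: distrib_left distrib_right linear_extension_add)
    show thesis
    proof (rule that[of e])
      show "2 * linear_extension g e = 1"
        using e by (simp add: A.primitive_def)
      show "multiplicative (\<lambda>x. 2 * linear_extension g (basis x * e))"
        unfolding multiplicative_def basis_mult
        using A.commutative_primitive_multiplicative[OF e comm'] by blast
    qed
  qed
qed

lemma noncommutative_solution:
  assumes noncomm: "g (x * y * w) \<noteq> g (y * x * w)"
  obtains R C where "trace_algebra.frame (linear_extension g) R C"
proof -
  interpret A: trace_algebra "linear_extension g" scale
    by (rule trace_algebra)
  have "linear_extension g (basis x * basis y * basis w) \<noteq>
      linear_extension g (basis y * basis x * basis w)"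
    using noncomm by (simp add: linear_extension_basis flip: basis_mult)
  then show thesis
    using A.ex_frame that by blast
qed

end

text \<open>
  A subspace that is invariant under the monoid is invariant under its linear span, which contains all matrix units.
  They carry any non-zero vector to every vector of the standard basis.
\<close>

lemma irreducible_frame_matrix:
  fixes g :: "'m::monoid_mult \<Rightarrow> complex"
  assumes "trace_algebra (linear_extension g) scale"
    and frame: "trace_algebra.frame (linear_extension g) R C"
  defines "P \<equiv> \<lambda>x. trace_algebra.frame_matrix (linear_extension g) R C (basis x)"
  shows "irreducible_representation (\<lambda>x. (*v) (P x))"
proof -
  interpret A: trace_algebra "linear_extension g" scale
    by fact
  have "representation (\<lambda>x. (*v) (P x))"
    unfolding representation_def
  proof (intro conjI allI)
    show "Vector_Spaces.linear (*s) (*s) ((*v) (P x))" for x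
      by (rule matrix_vector_mul_linear_gen)
    show "(*v) (P (x * y)) = (*v) (P x) \<circ> (*v) (P y)" for x y
      by (simp add: fun_eq_iff P_def basis_mult A.frame_matrix_mult[OF frame] matrix_vector_mul_assoc)
    show "(*v) (P 1) = id"
      by (simp add: fun_eq_iff P_def basis_one A.frame_matrix_one[OF frame])
  qed
  moreover have "W = {0} \<or> W = UNIV"
    if W: "vec.subspace W" and invariant: "\<forall>x. (*v) (P x) ` W \<subseteq> W" for W
  proof (cases "W = {0}")
    case False
    have inv: "A.frame_matrix R C a *v w \<in> W" if "w \<in> W" for a w
    proof (induction a rule: monoid_algebra_induct)
      case (scaled_basis k x)
      have "A.frame_matrix R C (scale k (basis x)) *v w = k *s (P x *v w)"
        by (simp add: P_def A.frame_matrix_def A.scale_left A.scale_right A.G_scale vec_eq_iff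
            matrix_vector_mult_def sum_distrib_left mult_ac)
      then show ?case
        using invariant that vec.subspace_scale[OF W] by auto
    next
      case (add a b)
      have "A.frame_matrix R C (a + b) = A.frame_matrix R C a + A.frame_matrix R C b"
        by (simp add: A.frame_matrix_def vec_eq_iff distrib_left distrib_right A.G_add)
      then show ?case
        using vec.subspace_add[OF W add.IH] by (simp add: matrix_vector_mult_add_rdistrib)
    qed
    obtain w where "w \<in> W" "w \<noteq> 0"
      using False vec.subspace_0[OF W] by blast
    then obtain l where l: "w $ l \<noteq> 0"
      by (auto simp: vec_eq_iff)
    have unit: "A.frame_matrix R C (C k * R l) *v w = (w $ l) *s axis k 1" for k
      by (simp add: vec_eq_iff matrix_vector_mult_def A.frame_matrix_unit[OF frame] axis_def
          if_distrib[where f = "\<lambda>c. c * _"] cong: if_cong)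
    have axis: "axis k 1 \<in> W" for k :: 2
      using vec.subspace_scale[OF W inv[OF \<open>w \<in> W\<close>, of "C k * R l"], of "1 / w $ l"] l
      by (simp add: unit)
    have "v \<in> W" for v
    proof -
      have "(\<Sum>k\<in>UNIV. (v $ k) *s axis k 1) \<in> W"
        by (intro vec.subspace_sum vec.subspace_scale W axis)
      then show ?thesis
        by (simp only: basis_expansion)
    qed
    then show ?thesis
      by blast
  qed simp
  ultimately show ?thesis
    by (simp add: irreducible_representation_def)
qed

theorem theorem4p4:
  fixes \<sigma> \<tau> :: "'m::topological_monoid_mult \<Rightarrow> 'm"
    and z\<^sub>0 :: 'm
    and f :: "'m \<Rightarrow> complex"
  assumes "involutive_automorphism \<sigma>"
    and "involutive_anti_automorphism \<tau>"
    and "continuous_on UNIV f"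
    and "\<exists>x. f x \<noteq> 0"
    and "\<And>x y. f (x * \<sigma> y * z\<^sub>0) + f (\<tau> y * x * z\<^sub>0) = 2 * f x * f y"
  shows "(abelian f \<longrightarrow>
           (\<exists>\<mu> :: 'm \<Rightarrow> complex.
              continuous_on UNIV \<mu> \<and> multiplicative \<mu> \<and>
              (\<forall>x. f x = f 1 * ((\<mu> x + (\<mu> \<circ> \<sigma> \<circ> \<tau>) x) / 2)) \<and>
              \<mu> \<circ> \<sigma> \<circ> \<tau> = \<mu> \<circ> \<tau> \<circ> \<sigma> \<and>
              (\<mu> \<circ> \<sigma> = \<mu> \<or> \<mu> \<circ> \<tau> = \<mu>) \<and>
              \<mu> (\<sigma> (\<tau> z\<^sub>0)) = \<mu> z\<^sub>0 \<and> \<mu> z\<^sub>0 = f 1)) \<and>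
         (\<not> abelian f \<longrightarrow>
           (\<exists>\<pi> :: 'm \<Rightarrow> complex ^ 2 \<Rightarrow> complex ^ 2.
              continuous_representation \<pi> \<and> irreducible_representation \<pi> \<and>
              (\<forall>x. f x = f 1 * character \<pi> x / 2) \<and>
              (\<forall>x. adj (\<pi> (\<sigma> x)) = \<pi> (\<tau> x)) \<and>
              (\<forall>x. tr (\<pi> x) = tr (\<pi> (\<sigma> x))) \<and>
              \<pi> z\<^sub>0 = (\<lambda>v. f 1 *s v)))"
proof -
  note equation = assms(5)
  \<comment> \<open>multiplicativity alone does not give this on a monoid, but surjectivity, here from involutivity, does\<close>
  have unit: "\<sigma> 1 = 1" "\<tau> 1 = 1"
    using assms(1,2) unfolding involutive_automorphism_def involutive_anti_automorphism_def
    by (metis mult_1_left mult_1_right)+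
  have f_z: "f (x * z\<^sub>0) = f 1 * f x" for x
    using equation[of x 1] by (simp add: unit)
  have "f 1 \<noteq> 0"
  proof
    assume "f 1 = 0"
    then have "f x = 0" for x
      using equation[of x x] by (simp add: f_z)
    then show False
      using assms(4) by blast
  qed
  define k where "k = f 1"
  have "k \<noteq> 0"
    using \<open>f 1 \<noteq> 0\<close> by (simp add: k_def)
  define g where "g x = f x / k" for x
  have f_g: "f x = k * g x" for x
    using \<open>k \<noteq> 0\<close> by (simp add: g_def)
  interpret normalized_solution \<sigma> \<tau> g
  proof
    show "g 1 = 1"
      using \<open>k \<noteq> 0\<close> by (simp add: g_def k_def)
    show "g (x * \<sigma> y) + g (\<tau> y * x) = 2 * g x * g y" for x y
    proof -
      have "k * (f (x * \<sigma> y) + f (\<tau> y * x)) = 2 * f x * f y"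
        using equation[of x y] by (simp add: f_z k_def distrib_left)
      then have "k * k * (g (x * \<sigma> y) + g (\<tau> y * x)) = k * k * (2 * g x * g y)"
        by (simp add: f_g algebra_simps)
      then show ?thesis
        using \<open>k \<noteq> 0\<close> by simp
    qed
  qed fact+
  interpret A: trace_algebra "linear_extension g" scale
    by (rule trace_algebra)
  have abelian: "abelian f \<longleftrightarrow> (\<forall>x y w. g (x * y * w) = g (y * x * w))"
    using abelian_iff[of f] central \<open>k \<noteq> 0\<close> by (simp add: f_g)
  have continuous_g: "continuous_on UNIV g"
    unfolding g_def using assms(3) \<open>k \<noteq> 0\<close> by (intro continuous_intros) auto
  have g_z: "g (x * z\<^sub>0) = k * g x" for x
    using f_z[of x] \<open>k \<noteq> 0\<close> by (simp add: g_def k_def)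
  have z_relation: "linear_extension g (basis z\<^sub>0 * a) = k * linear_extension g a" for a
    using linear_extension_relation[of g z\<^sub>0 k 0 1 a] g_z central[of z\<^sub>0] by simp
  have \<tau>\<sigma>: "linear_extension g (basis (\<tau> (\<sigma> x)) * a) =
      2 * g x * linear_extension g a - linear_extension g (basis x * a)" for x a
    using linear_extension_relation[OF \<tau>\<sigma>_relation] by simp
  have \<sigma>\<tau>: "linear_extension g (basis (\<sigma> (\<tau> x)) * a) =
      2 * g x * linear_extension g a - linear_extension g (basis x * a)" for x a
    using linear_extension_relation[OF \<sigma>\<tau>_relation] by simp
  show ?thesis
  proof (intro conjI impI)
    assume "abelian f"
    then obtain a where a: "2 * linear_extension g a = 1"
      and "multiplicative (\<lambda>x. 2 * linear_extension g (basis x * a))"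
      using commutative_solution abelian by metis
    define \<mu> where "\<mu> x = 2 * linear_extension g (basis x * a)" for x
    have \<mu>: "multiplicative \<mu>"
      using \<open>multiplicative _\<close> by (simp add: \<mu>_def[abs_def])
    have \<mu>_\<sigma>\<tau>: "\<mu> (\<sigma> (\<tau> x)) = 2 * g x - \<mu> x" and \<mu>_\<tau>\<sigma>: "\<mu> (\<tau> (\<sigma> x)) = 2 * g x - \<mu> x" for x
      using a arg_cong[OF a, of "\<lambda>c. 2 * g x * c"]
      by (simp_all add: \<mu>_def \<sigma>\<tau> \<tau>\<sigma> algebra_simps)
    have \<mu>_z: "\<mu> z\<^sub>0 = k"
      using a by (simp add: \<mu>_def z_relation)
    show "\<exists>\<mu> :: 'm \<Rightarrow> complex.
              continuous_on UNIV \<mu> \<and> multiplicative \<mu> \<and>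
              (\<forall>x. f x = f 1 * ((\<mu> x + (\<mu> \<circ> \<sigma> \<circ> \<tau>) x) / 2)) \<and>
              \<mu> \<circ> \<sigma> \<circ> \<tau> = \<mu> \<circ> \<tau> \<circ> \<sigma> \<and>
              (\<mu> \<circ> \<sigma> = \<mu> \<or> \<mu> \<circ> \<tau> = \<mu>) \<and>
              \<mu> (\<sigma> (\<tau> z\<^sub>0)) = \<mu> z\<^sub>0 \<and> \<mu> z\<^sub>0 = f 1"
    proof (intro exI[of _ \<mu>] conjI allI)
      show "continuous_on UNIV \<mu>"
        unfolding \<mu>_def
        by (intro continuous_intros continuous_on_linear_extension continuous_g)
      show "multiplicative \<mu>"
        by (rule \<mu>)
      show "f x = f 1 * ((\<mu> x + (\<mu> \<circ> \<sigma> \<circ> \<tau>) x) / 2)" for x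
        by (simp add: \<mu>_\<sigma>\<tau> f_g one)
      show "\<mu> \<circ> \<sigma> \<circ> \<tau> = \<mu> \<circ> \<tau> \<circ> \<sigma>"
        by (simp add: fun_eq_iff \<mu>_\<sigma>\<tau> \<mu>_\<tau>\<sigma>)
      \<comment> \<open>both \<open>\<mu> + \<mu> \<circ> \<tau> \<circ> \<sigma>\<close> and its composition with \<open>\<sigma>\<close>, which is \<open>\<mu> \<circ> \<sigma> + \<mu> \<circ> \<tau>\<close>, equal \<open>2 * g\<close>\<close>
      have "\<mu> \<circ> \<sigma> = \<mu> \<or> \<mu> \<circ> \<sigma> = \<mu> \<circ> \<tau> \<circ> \<sigma>"
      proof (rule multiplicative_sum_unique)
        show "multiplicative (\<mu> \<circ> \<tau> \<circ> \<sigma>)" "multiplicative (\<mu> \<circ> \<sigma>)" "multiplicative (\<mu> \<circ> \<tau>)"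
          using \<mu> by (simp_all add: multiplicative_def mult.commute)
        show "\<mu> x + (\<mu> \<circ> \<tau> \<circ> \<sigma>) x = (\<mu> \<circ> \<sigma>) x + (\<mu> \<circ> \<tau>) x" for x
          using \<mu>_\<tau>\<sigma>[of x] \<mu>_\<tau>\<sigma>[of "\<sigma> x"] by simp
      qed (rule \<mu>)
      then show "\<mu> \<circ> \<sigma> = \<mu> \<or> \<mu> \<circ> \<tau> = \<mu>"
        by (metis \<sigma>_simps(2) comp_apply fun_eq_iff)
      show "\<mu> z\<^sub>0 = f 1"
        by (simp add: \<mu>_z k_def)
      show "\<mu> (\<sigma> (\<tau> z\<^sub>0)) = \<mu> z\<^sub>0"
        using g_z[of 1] by (simp add: \<mu>_\<sigma>\<tau> \<mu>_z one)
    qed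
  next
    assume "\<not> abelian f"
    then obtain R C where frame: "A.frame R C"
      using noncommutative_solution abelian by metis
    define P where "P x = A.frame_matrix R C (basis x)" for x
    have P_entry: "P x $ i $ j = 2 * linear_extension g (basis x * (C j * R i))" for x i j
      using A.G_commute[of "R i" "basis x * C j"] by (simp add: P_def A.frame_matrix_def mult.assoc)
    have dual: "2 * linear_extension g (C j * R i) = (if i = j then 1 else 0)" for i j
      using frame A.G_commute[of "C j" "R i"] by (simp add: A.frame_def)
    have trace_P: "trace (P x) = 2 * g x" for x
      by (simp add: P_def A.trace_frame_matrix[OF frame] linear_extension_basis)
    have irreducible: "irreducible_representation (\<lambda>x. (*v) (P x))"
      unfolding P_def using trace_algebra frame by (rule irreducible_frame_matrix)
    have P_z: "P z\<^sub>0 = mat k"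
      using dual by (simp add: vec_eq_iff P_entry z_relation mat_def mult.left_commute)
    have P_\<tau>: "P (\<tau> x) = mat (2 * g x) - P (\<sigma> x)" for x
    proof -
      have rel: "2 * linear_extension g (basis (\<tau> x) * a) =
          2 * g x * (2 * linear_extension g a) - 2 * linear_extension g (basis (\<sigma> x) * a)" for a
      proof -
        have eq: "linear_extension g (basis (\<tau> x) * a) =
            2 * g x * linear_extension g a - linear_extension g (basis (\<sigma> x) * a)"
          using \<tau>\<sigma>[of "\<sigma> x" a] by simp
        show ?thesis
          unfolding eq by (simp add: algebra_simps)
      qed
      have "P (\<tau> x) $ i $ j = (mat (2 * g x) - P (\<sigma> x)) $ i $ j" for i j
        unfolding P_entry[of "\<tau> x"] rel dual by (simp add: P_entry mat_def)
      then show ?thesis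
        by (simp add: vec_eq_iff)
    qed
    have mat_mult: "mat k *v v = k *s v" for k and v :: "complex ^ 2"
      by (simp add: vec_eq_iff matrix_vector_mult_def mat_def
          if_distrib[where f = "\<lambda>c. c * _"] cong: if_cong)
    show "\<exists>\<pi> :: 'm \<Rightarrow> complex ^ 2 \<Rightarrow> complex ^ 2.
              continuous_representation \<pi> \<and> irreducible_representation \<pi> \<and>
              (\<forall>x. f x = f 1 * character \<pi> x / 2) \<and>
              (\<forall>x. adj (\<pi> (\<sigma> x)) = \<pi> (\<tau> x)) \<and>
              (\<forall>x. tr (\<pi> x) = tr (\<pi> (\<sigma> x))) \<and>
              \<pi> z\<^sub>0 = (\<lambda>v. f 1 *s v)"
    proof (intro exI[of _ "\<lambda>x. (*v) (P x)"] conjI allI)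
      show "irreducible_representation (\<lambda>x. (*v) (P x))"
        by (rule irreducible)
      have "continuous_on UNIV (\<lambda>x. \<chi> i j. 2 * linear_extension g (basis x * (C j * R i)))"
        by (intro continuous_intros continuous_on_linear_extension continuous_g)
      also have "(\<lambda>x. \<chi> i j. 2 * linear_extension g (basis x * (C j * R i))) = P"
        by (simp add: fun_eq_iff vec_eq_iff P_entry)
      finally show "continuous_representation (\<lambda>x. (*v) (P x))"
        using irreducible
        by (simp add: continuous_representation_def irreducible_representation_def)
      show "f x = f 1 * character (\<lambda>x. (*v) (P x)) x / 2" for x
        by (simp add: character_def tr_def trace_P f_g one)
      show "adj ((*v) (P (\<sigma> x))) = (*v) (P (\<tau> x))" for x
        by (simp add: fun_eq_iff adj_def tr_def trace_P P_\<tau> mat_mult matrix_vector_mult_diff_rdistrib)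
      show "tr ((*v) (P x)) = tr ((*v) (P (\<sigma> x)))" for x
        by (simp add: tr_def trace_P)
      show "(*v) (P z\<^sub>0) = (\<lambda>v. f 1 *s v)"
        by (simp add: fun_eq_iff P_z mat_mult k_def)
    qed
  qed
qed

end
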